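(* Let $\varphi:\mathbb{R}^n\to\mathbb{R}$ be a differentiable convex function, let $\psi:\mathbb{R}^n\to\mathbb{R}\cup\{\infty\}$ be a closed convex function whose proximal map (defined in the context) is computable for $t>0$, and let $f:=\varphi+\psi$. Suppose $\bar f=\min_{x\in\mathbb{R}^n}f(x)$ is finite, $\theta_k\in(0,1]$, $k=0,1,2,\dots$, satisfy $\theta_0=1$ and $\theta_{k+1}^2\ge\theta_k^2(1-\theta_{k+1})$, and the step sizes $t_k>0$, $k=0,1,2,\dots$, are non-increasing and such that the decrease condition $$f(x_{k+1})\le\min_{x\in\mathbb{R}^n}\left\{\varphi(y_k)+\langle\nabla\varphi(y_k),x-y_k\rangle+\frac{1}{2t_k}\|x-y_k\|^2+\psi(x)\right\}$$ holds for $k=0,1,2,\dots$. Here $x_k\in\mathbb{R}^n$, $k=1,2,\dots$, are the iterates, and $y_k$, $g_k$ the associated vectors, generated from $x_0\in\mathbb{R}^n$ by the proximal gradient template (defined in the context) with these $\theta_k$ and $t_k$. Let $z_k\in\mathbb{R}^n$, $k=1,2,\dots$, be $$z_k=\frac{\theta_{k-1}^2}{t_{k-1}}\cdot\sum_{i=0}^{k-1}\frac{t_i}{\theta_i}g_i.$$ Then for $k=1,2,\dots$ $$f(x_k)-\bar f\le-\bigl(R_k\cdot(f-\bar f)\bigr)^*(z_k)+\langle z_k,x_0\rangle-\frac{t_{k-1}}{2\theta_{k-1}^2}\|z_k\|^2,$$ where $R_1=1$ and $$R_{k+1}=\frac{t_{k-1}}{t_k}\cdot\frac{\theta_k^2}{\theta_{k-1}^2(1-\theta_k)}\cdot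 R_k\ge1,\qquad k=1,2,\dots.$$ In particular, if $\bar X=\{x\in\mathbb{R}^n:f(x)=\bar f\}$ is nonempty, then $$f(x_k)-\bar f\le\min_{u\in\mathbb{R}^n}\left\{R_k\cdot(f(u)-\bar f)+\frac{\theta_{k-1}^2}{2t_{k-1}}\|u-x_0\|^2\right\}=\frac{\theta_{k-1}^2\cdot\mathrm{dist}(x_0,\bar X)^2}{2t_{k-1}}.$$
   Context: $\mathbb{R}^n$ is endowed with an inner product $\langle\cdot,\cdot\rangle$ and $\|\cdot\|$ is the corresponding Euclidean norm; $\mathrm{dist}(x,S)=\inf_{s\in S}\|x-s\|$. For a convex function $h:\mathbb{R}^n\to\mathbb{R}\cup\{\infty\}$, the convex conjugate is $h^*(z)=\sup_{x\in\mathbb{R}^n}\{\langle z,x\rangle-h(x)\}$; thus $(R\cdot(f-\bar f))^*$ denotes the conjugate of the function $x\mapsto R\,(f(x)-\bar f)$. For $t>0$ the proximal map of $\psi$ is $\mathrm{Prox}_t(x):=\arg\min_{y\in\mathbb{R}^n}\left\{\psi(y)+\frac{1}{2t}\|x-y\|^2\right\}$. Proximal gradient template: given $x_0\in\mathbb{R}^n$, set $y_0:=x_0$ and $\theta_0:=1$; for $k=0,1,2,\dots$ pick $t_k>0$, set $x_{k+1}:=\mathrm{Prox}_{t_k}(y_k-t_k\nabla\varphi(y_k))$, pick $\theta_{k+1}\in(0,1]$, and set $$y_{k+1}:=x_{k+1}+\frac{\theta_{k+1}(1-\theta_k)}{\theta_k}(x_{k+1}-x_k).$$ The vectors $g_k$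 are given by $x_{k+1}=y_k-t_kg_k$; by the optimality conditions for the proximal step, $g_k=g_k^\varphi+g_k^\psi$ with $g_k^\varphi=\nabla\varphi(y_k)$ and some $g_k^\psi\in\partial\psi(x_{k+1})$.
   Formalization: The final "=" is proved as "≤" (with the min attained): equality fails for φ(u)=u²/2, ψ=0, t_k=1, x_0=1, k=1 (1/4 versus 1/2). Where θ_k=1 for some k≥1, R_{k+1} is read as ∞, with ∞·0=0. *)

theory Defs
  imports "HOL-Analysis.Analysis"
begin

definition ereal_epigraph :: "('a \<Rightarrow> ereal) \<Rightarrow> ('a \<times> real) set" where
  "ereal_epigraph h = {(x, r). h x \<le> ereal r}"

text \<open>
  A closed convex function into \<open>\<real> \<union> {\<infinity>}\<close>: the value \<open>-\<infinity>\<close> is excluded, and the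
  epigraph is convex and closed. The function that is constantly \<open>\<infinity>\<close> is allowed.
\<close>

definition closed_convex_fun :: "('a::real_normed_vector \<Rightarrow> ereal) \<Rightarrow> bool" where
  "closed_convex_fun h \<longleftrightarrow>
     (\<forall>x. h x \<noteq> -\<infinity>) \<and> convex (ereal_epigraph h) \<and> closed (ereal_epigraph h)"

definition convex_conjugate :: "('a::real_inner \<Rightarrow> ereal) \<Rightarrow> 'a \<Rightarrow> ereal" where
  "convex_conjugate h z = (SUP x. ereal (z \<bullet> x) - h x)"

definition gradient :: "('a::real_inner \<Rightarrow> real) \<Rightarrow> 'a \<Rightarrow> 'a" where
  "gradient \<phi> x = (THE D. GDERIV \<phi> x :> D)"

text \<open>
  The minimiser exists and is unique when \<open>\<psi>\<close> is a closed convex function on a Euclidean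
  space, not constantly \<open>\<infinity>\<close>, and \<open>t > 0\<close>.
\<close>

definition prox :: "('a::real_normed_vector \<Rightarrow> ereal) \<Rightarrow> real \<Rightarrow> 'a \<Rightarrow> 'a" where
  "prox \<psi> t x = arg_min (\<lambda>y. \<psi> y + ereal (1 / (2 * t) * (norm (x - y))\<^sup>2)) (\<lambda>_. True)"

end

theory Submission
  imports Defs
begin

text \<open>
  Put \<open>v k = x0 - (\<Sum>i<k. (t i / \<theta> i) *\<^sub>R g i)\<close>, \<open>A k = t k / (\<theta> k)\<^sup>2\<close> and
  \<open>B k = (\<Sum>i<k. t i / \<theta> i)\<close>. The extrapolation rule says that
  \<open>y k = (1 - \<theta> k) *\<^sub>R x k + \<theta> k *\<^sub>R v k\<close>, so the three-point inequality for the proximal step,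
  tested at \<open>(1 - \<theta> k) *\<^sub>R x k + \<theta> k *\<^sub>R u\<close>, gives by induction
  \<open>A k * (f (x (k + 1)) - fbar) + (norm (u - v (k + 1)))\<^sup>2 / 2
     \<le> B (k + 1) * (f u - fbar) + (norm (u - x0))\<^sup>2 / 2\<close>.
  The recursion for \<open>R\<close> yields \<open>R (k + 1) \<ge> B (k + 1) / A k\<close>, also where \<open>R\<close> is infinite.
  As \<open>x0 - v (k + 1) = A k *\<^sub>R z (k + 1)\<close>, expanding the squares and taking the infimum over \<open>u\<close>
  produces the conjugate.
\<close>

section \<open>Tangents and Jensen's inequality\<close>

text \<open>Along the line through \<open>y\<close> and \<open>u\<close> this is the tangent bound
  for a convex function of one real variable. Since \<open>gradient\<close> is a definite
  description, existence and uniqueness of the representing vector come first.\<close>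

lemma gradient_tangent_below:
  fixes \<phi> :: "'a::euclidean_space \<Rightarrow> real"
  assumes diff: "\<phi> differentiable (at y)" and cvx: "convex_on UNIV \<phi>"
  shows "\<phi> y + gradient \<phi> y \<bullet> (u - y) \<le> \<phi> u"
proof -
  obtain D where D: "(\<phi> has_derivative D) (at y)"
    using diff by (auto simp: differentiable_def)
  have "linear D" using D has_derivative_linear by blast
  \<comment> \<open>Riesz representation of the derivative in coordinates.\<close>
  have "D = (\<lambda>h. h \<bullet> (\<Sum>b\<in>Basis. D b *\<^sub>R b))"
  proof
    fix h
    have "D h = D (\<Sum>b\<in>Basis. (h \<bullet> b) *\<^sub>R b)"
      by (simp add: euclidean_representation)
    also have "\<dots> = (\<Sum>b\<in>Basis. (h \<bullet> b) * D b)"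
      using \<open>linear D\<close> by (simp add: linear_sum linear_scale)
    finally show "D h = h \<bullet> (\<Sum>b\<in>Basis. D b *\<^sub>R b)"
      by (simp add: inner_sum_right mult.commute)
  qed
  then have "GDERIV \<phi> y :> (\<Sum>b\<in>Basis. D b *\<^sub>R b)"
    using D unfolding gderiv_def by metis
  moreover have "E = E'" if "GDERIV \<phi> y :> E" "GDERIV \<phi> y :> E'" for E E'
  proof -
    have "(\<lambda>h. h \<bullet> E) = (\<lambda>h. h \<bullet> E')"
      using that has_derivative_unique unfolding gderiv_def by blast
    then show ?thesis
      by (metis inner_commute vector_eq_ldot)
  qed
  ultimately have G: "GDERIV \<phi> y :> gradient \<phi> y"
    unfolding gradient_def by (metis the_equality)
  define l where "l = (\<lambda>s::real. \<phi> (y + s *\<^sub>R (u - y)))"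
  have "convex_on UNIV l"
  proof (rule convex_onI)
    fix s a b :: real assume "0 < s" "s < 1"
    have "y + ((1 - s) *\<^sub>R a + s *\<^sub>R b) *\<^sub>R (u - y) =
        (1 - s) *\<^sub>R (y + a *\<^sub>R (u - y)) + s *\<^sub>R (y + b *\<^sub>R (u - y))"
      by (simp add: algebra_simps)
    then show "l ((1 - s) *\<^sub>R a + s *\<^sub>R b) \<le> (1 - s) * l a + s * l b"
      unfolding l_def using convex_onD[OF cvx, of s] \<open>0 < s\<close> \<open>s < 1\<close> by simp
  qed simp
  moreover have "(l has_field_derivative gradient \<phi> y \<bullet> (u - y)) (at 0)"
  proof -
    have "(\<phi> has_derivative (\<lambda>h. h \<bullet> gradient \<phi> y)) (at (y + 0 *\<^sub>R (u - y)))"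
      using G by (simp add: gderiv_def)
    moreover have "((\<lambda>s. y + s *\<^sub>R (u - y)) has_derivative (\<lambda>s. s *\<^sub>R (u - y))) (at 0)"
      by (auto intro!: derivative_eq_intros)
    ultimately have "(l has_derivative (\<lambda>s. (s *\<^sub>R (u - y)) \<bullet> gradient \<phi> y)) (at 0)"
      unfolding l_def using has_derivative_compose by blast
    moreover have "(\<lambda>s. (s *\<^sub>R (u - y)) \<bullet> gradient \<phi> y) = (*) (gradient \<phi> y \<bullet> (u - y))"
      by (simp add: fun_eq_iff inner_commute[of "u - y"] mult.commute)
    ultimately show ?thesis
      unfolding has_field_derivative_def by metis
  qed
  ultimately have "l 1 - l 0 \<ge> (gradient \<phi> y \<bullet> (u - y)) * (1 - 0)"
    by (intro convex_on_imp_above_tangent[where A = UNIV]) auto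
  then show ?thesis by (simp add: l_def)
qed

text \<open>Real upper bounds stand in for the values of \<open>h\<close>, so convexity can be used
  without arithmetic on infinite values.\<close>

lemma convex_ereal_epigraphD:
  assumes "convex (ereal_epigraph h)" "h u \<le> ereal a" "h v \<le> ereal b" "0 \<le> s" "s \<le> 1"
  shows "h ((1 - s) *\<^sub>R u + s *\<^sub>R v) \<le> ereal ((1 - s) * a + s * b)"
proof -
  have "(1 - s) *\<^sub>R (u, a) + s *\<^sub>R (v, b) \<in> ereal_epigraph h"
    using assms by (intro convexD[OF assms(1)]) (auto simp: ereal_epigraph_def)
  then show ?thesis by (simp add: ereal_epigraph_def)
qed

lemma ereal_add_le_iff: "X + ereal a \<le> ereal b \<longleftrightarrow> X \<le> ereal (b - a)"
  by (cases X) auto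

text \<open>The last term is the strong convexity of the squared norm. It bounds sublevel sets and
  supplies the extra square in the three-point inequality.\<close>

lemma power2_norm_convex_combination:
  fixes u v :: "'a::real_inner"
  shows "(norm ((1 - s) *\<^sub>R u + s *\<^sub>R v))\<^sup>2 =
    (1 - s) * (norm u)\<^sup>2 + s * (norm v)\<^sup>2 - s * (1 - s) * (norm (v - u))\<^sup>2"
  unfolding power2_norm_eq_inner
  by (simp add: inner_add inner_diff inner_commute algebra_simps power2_eq_square)

section \<open>Minimising a closed convex function plus a square\<close>

text \<open>Sublevel sets are closed because the epigraph is, and bounded because the value at a
  midpoint drops with the squared distance of the endpoints but cannot fall below \<open>b\<close>.
  Nested compact sublevel sets then share a point.\<close>

lemma closed_convex_fun_plus_square_attains_min:
  fixes h :: "'a::euclidean_space \<Rightarrow> ereal"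
  assumes h: "closed_convex_fun h" and "c > 0"
    and lower: "\<And>u. ereal b \<le> h u + ereal (c * (norm (u - p))\<^sup>2)"
    and fin: "h u0 \<noteq> \<infinity>"
  shows "\<exists>u. \<forall>w. h u + ereal (c * (norm (u - p))\<^sup>2) \<le> h w + ereal (c * (norm (w - p))\<^sup>2)"
proof -
  define Q where "Q = (\<lambda>u. h u + ereal (c * (norm (u - p))\<^sup>2))"
  define L where "L = (\<lambda>r. {u. Q u \<le> ereal r})"
  have L: "u \<in> L r \<longleftrightarrow> h u \<le> ereal (r - c * (norm (u - p))\<^sup>2)" for u r
    by (simp add: L_def Q_def ereal_add_le_iff)
  have cvx: "convex (ereal_epigraph h)" and cl: "closed (ereal_epigraph h)"
    using h by (auto simp: closed_convex_fun_def)
  have "closed (L r)" for r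
  proof -
    have "L r = (\<lambda>u. (u, r - c * (norm (u - p))\<^sup>2)) -` ereal_epigraph h"
      by (auto simp: L ereal_epigraph_def)
    then show ?thesis
      using cl by (auto intro!: closed_vimage continuous_intros)
  qed
  moreover have "bounded (L r)" for r
  proof -
    \<comment> \<open>At the midpoint, \<open>Q\<close> is at most \<open>r\<close> minus
      \<open>c / 4\<close> times the squared distance of \<open>u\<close> and \<open>v\<close>;
      comparison with \<open>b\<close> gives the diameter bound.\<close>
    have "norm (v - u) \<le> sqrt (4 * (r - b) / c)" if "u \<in> L r" "v \<in> L r" for u v
    proof -
      let ?m = "(1 - 1/2) *\<^sub>R u + (1/2) *\<^sub>R v"
      have "h ?m \<le> ereal ((1 - 1/2) * (r - c * (norm (u - p))\<^sup>2) + 1/2 * (r - c * (norm (v - p))\<^sup>2))"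
        using that by (intro convex_ereal_epigraphD[OF cvx]) (auto simp: L)
      moreover have "?m - p = (1 - 1/2) *\<^sub>R (u - p) + (1/2) *\<^sub>R (v - p)"
        by (simp add: algebra_simps flip: scaleR_add_left)
      then have "(norm (?m - p))\<^sup>2 = (1 - 1/2) * (norm (u - p))\<^sup>2 + 1/2 * (norm (v - p))\<^sup>2
          - 1/2 * (1 - 1/2) * (norm (v - u))\<^sup>2"
        by (simp only: power2_norm_convex_combination) simp
      then have "(1 - 1/2) * (r - c * (norm (u - p))\<^sup>2) + 1/2 * (r - c * (norm (v - p))\<^sup>2)
          = r - c / 4 * (norm (v - u))\<^sup>2 - c * (norm (?m - p))\<^sup>2"
        by (simp only:) (simp add: algebra_simps)
      ultimately have "Q ?m \<le> ereal (r - c / 4 * (norm (v - u))\<^sup>2)"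
        unfolding Q_def ereal_add_le_iff by metis
      with lower[of ?m] have "b \<le> r - c / 4 * (norm (v - u))\<^sup>2"
        unfolding Q_def using ereal_less_eq(3) order_trans by blast
      then have "(norm (v - u))\<^sup>2 \<le> 4 * (r - b) / c"
        using \<open>c > 0\<close> by (simp add: field_simps)
      then show ?thesis by (simp add: real_le_rsqrt)
    qed
    then have "\<forall>v\<in>L r. dist u v \<le> sqrt (4 * (r - b) / c)" if "u \<in> L r" for u
      using that by (simp add: dist_norm norm_minus_commute)
    then show ?thesis
      using bounded_any_center by (cases "L r = {}") blast+
  qed
  ultimately have "compact (L r)" for r
    by (simp add: compact_eq_bounded_closed)
  have "ereal b \<le> (INF u. Q u)"
    using lower by (auto simp: Q_def intro: INF_greatest)
  moreover have "(INF u. Q u) \<le> Q u0" by (rule INF_lower) simp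
  moreover have "Q u0 \<noteq> \<infinity>" using fin by (simp add: Q_def)
  ultimately obtain \<mu> where \<mu>: "(INF u. Q u) = ereal \<mu>"
    by (cases "INF u. Q u") auto
  \<comment> \<open>The levels decrease to the infimum \<open>\<mu>\<close>, so a common point of
    these sets attains it.\<close>
  define F where "F = (\<lambda>n. L (\<mu> + 1 / real (Suc n)))"
  have "\<Inter> (range F) \<noteq> {}"
  proof (rule compact_nest)
    show "compact (F n)" for n using \<open>\<And>r. compact (L r)\<close> by (simp add: F_def)
    show "F n \<noteq> {}" for n
    proof -
      have "(INF u. Q u) < ereal (\<mu> + 1 / real (Suc n))" by (simp add: \<mu>)
      then obtain u where "Q u < ereal (\<mu> + 1 / real (Suc n))" by (auto simp: INF_less_iff)
      then show ?thesis by (auto simp: F_def L_def intro: less_imp_le)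
    qed
    show "F n \<subseteq> F m" if "m \<le> n" for m n
    proof -
      have "\<mu> + 1 / real (Suc n) \<le> \<mu> + 1 / real (Suc m)"
        using that by (simp add: frac_le)
      then show ?thesis unfolding F_def L_def
        using order_trans ereal_less_eq(3) by blast
    qed
  qed
  then obtain u where u: "\<And>n. Q u \<le> ereal (\<mu> + 1 / real (Suc n))"
    by (auto simp: F_def L_def)
  have "(\<lambda>n. ereal (\<mu> + 1 / real (Suc n))) \<longlonglongrightarrow> ereal (\<mu> + 0)"
    by (intro tendsto_intros LIMSEQ_Suc lim_1_over_n)
  then have "Q u \<le> ereal \<mu>"
    using u LIMSEQ_le_const[of _ "ereal \<mu>" "Q u"] by auto
  then have "Q u \<le> Q w" for w
    using INF_lower[of w UNIV Q] by (simp add: \<mu>)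
  then show ?thesis by (auto simp: Q_def)
qed

text \<open>Minimality of \<open>u\<close> is tested at points of the segment to \<open>w\<close>.
  After division by the step length, the strong convexity term survives as the step shrinks.\<close>

lemma minimizer_plus_square_three_point:
  fixes h :: "'a::real_inner \<Rightarrow> ereal"
  assumes cvx: "convex (ereal_epigraph h)"
    and min: "\<And>w. h u + ereal (c * (norm (u - p))\<^sup>2) \<le> h w + ereal (c * (norm (w - p))\<^sup>2)"
    and a: "h u = ereal a" and b: "h w \<le> ereal b"
  shows "a + c * (norm (u - p))\<^sup>2 + c * (norm (w - u))\<^sup>2 \<le> b + c * (norm (w - p))\<^sup>2"
proof -
  have "r * (c * (norm (w - u))\<^sup>2) \<le> b + c * (norm (w - p))\<^sup>2 - a - c * (norm (u - p))\<^sup>2"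
    if r: "0 < r" "r < 1" for r
  proof -
    \<comment> \<open>Cancelling the step \<open>s\<close> leaves the factor
      \<open>1 - s = r\<close>; bounds for all \<open>r\<close> in the open unit interval replace
      the limit.\<close>
    define s where "s = 1 - r"
    have s: "0 < s" "s < 1" using r by (auto simp: s_def)
    let ?m = "(1 - s) *\<^sub>R u + s *\<^sub>R w"
    have "h ?m \<le> ereal ((1 - s) * a + s * b)"
      using a b s by (intro convex_ereal_epigraphD[OF cvx]) auto
    then have "ereal (a + c * (norm (u - p))\<^sup>2) \<le> ereal ((1 - s) * a + s * b) + ereal (c * (norm (?m - p))\<^sup>2)"
      using min[of ?m] a add_right_mono order_trans by fastforce
    moreover have "?m - p = (1 - s) *\<^sub>R (u - p) + s *\<^sub>R (w - p)"
      by (simp add: algebra_simps)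
    then have "(norm (?m - p))\<^sup>2 = (1 - s) * (norm (u - p))\<^sup>2 + s * (norm (w - p))\<^sup>2
        - s * (1 - s) * (norm (w - u))\<^sup>2"
      by (simp only: power2_norm_convex_combination) simp
    ultimately have "a + c * (norm (u - p))\<^sup>2 \<le> (1 - s) * a + s * b +
        c * ((1 - s) * (norm (u - p))\<^sup>2 + s * (norm (w - p))\<^sup>2 - s * (1 - s) * (norm (w - u))\<^sup>2)"
      by (simp only: plus_ereal.simps ereal_less_eq)
    then have "s * ((1 - s) * (c * (norm (w - u))\<^sup>2))
        \<le> s * (b + c * (norm (w - p))\<^sup>2 - a - c * (norm (u - p))\<^sup>2)"
      by (simp add: algebra_simps)
    then show ?thesis using s by (simp add: s_def)
  qed
  then have "c * (norm (w - u))\<^sup>2 \<le> b + c * (norm (w - p))\<^sup>2 - a - c * (norm (u - p))\<^sup>2"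
    by (rule field_le_mult_one_interval)
  then show ?thesis by simp
qed

text \<open>The decrease condition bounds the model from below by \<open>\<beta>\<close>, so the proximal point exists
  without an affine minorant of \<open>\<psi>\<close>.\<close>

lemma prox_step_bound:
  fixes \<phi> :: "'a::euclidean_space \<Rightarrow> real"
  assumes tangent: "\<And>u. \<phi> y + G \<bullet> (u - y) \<le> \<phi> u"
    and \<psi>: "closed_convex_fun \<psi>" and "t > 0"
    and x: "x = prox \<psi> t (y - t *\<^sub>R G)"
    and decrease: "ereal (\<phi> x) + \<psi> x \<le>
        (INF u. ereal (\<phi> y + G \<bullet> (u - y) + 1 / (2 * t) * (norm (u - y))\<^sup>2) + \<psi> u)"
    and lower: "ereal \<beta> \<le> ereal (\<phi> x) + \<psi> x"
    and w: "ereal (\<phi> w) + \<psi> w \<le> ereal b"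
  shows "ereal (\<phi> x) + \<psi> x \<le> ereal (b + 1 / (2 * t) * ((norm (w - y))\<^sup>2 - (norm (w - x))\<^sup>2))"
proof -
  define p where "p = y - t *\<^sub>R G"
  define c where "c = 1 / (2 * t)"
  define d where "d = t / 2 * (norm G)\<^sup>2 - \<phi> y"
  have "c > 0" using \<open>t > 0\<close> by (simp add: c_def)
  \<comment> \<open>Completing the square: up to the constant \<open>d\<close>, the quadratic model
    of \<open>\<phi>\<close> at \<open>y\<close> is the proximal penalty centred at
    \<open>p\<close>.\<close>
  have square: "c * (norm (u - p))\<^sup>2 = \<phi> y + G \<bullet> (u - y) + c * (norm (u - y))\<^sup>2 + d" for u
  proof -
    have "u - p = (u - y) + t *\<^sub>R G" by (simp add: p_def)
    then have "(norm (u - p))\<^sup>2 = (norm (u - y))\<^sup>2 + 2 * t * (G \<bullet> (u - y)) + t\<^sup>2 * (norm G)\<^sup>2"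
      by (simp only: power2_norm_eq_inner inner_add_left inner_add_right inner_scaleR_left
          inner_scaleR_right inner_commute[of "u - y" G]) (simp add: power2_eq_square algebra_simps)
    then have "c * (norm (u - p))\<^sup>2 =
        c * (norm (u - y))\<^sup>2 + (c * (2 * t)) * (G \<bullet> (u - y)) + (c * t\<^sup>2) * (norm G)\<^sup>2"
      by (simp only: distrib_left mult.assoc)
    moreover have "c * (2 * t) = 1" "c * t\<^sup>2 = t / 2"
      using \<open>t > 0\<close> by (simp_all add: c_def power2_eq_square)
    ultimately show ?thesis by (simp add: d_def)
  qed
  have model: "ereal (\<phi> x) + \<psi> x + ereal d \<le> \<psi> u + ereal (c * (norm (u - p))\<^sup>2)" for u
  proof -
    have "ereal (\<phi> x) + \<psi> x \<le> ereal (\<phi> y + G \<bullet> (u - y) + c * (norm (u - y))\<^sup>2) + \<psi> u"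
      using decrease unfolding c_def by (rule order_trans) (rule INF_lower, simp)
    then show ?thesis
      unfolding square by (cases "\<psi> x"; cases "\<psi> u") auto
  qed
  have "\<psi> w \<noteq> \<infinity>" using w by auto
  have "ereal (\<beta> + d) \<le> \<psi> u + ereal (c * (norm (u - p))\<^sup>2)" for u
    using order_trans[OF add_right_mono[OF lower] model] by simp
  then have "\<exists>u. \<forall>w. \<psi> u + ereal (c * (norm (u - p))\<^sup>2) \<le> \<psi> w + ereal (c * (norm (w - p))\<^sup>2)"
    using closed_convex_fun_plus_square_attains_min[OF \<psi> \<open>c > 0\<close>] \<open>\<psi> w \<noteq> \<infinity>\<close> by blast
  then have "\<exists>u. is_arg_min (\<lambda>u. \<psi> u + ereal (1 / (2 * t) * (norm (p - u))\<^sup>2)) (\<lambda>_. True) u"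
    by (simp add: is_arg_min_linorder c_def norm_minus_commute[of p])
  \<comment> \<open>\<open>arg_min\<close> is a Hilbert choice, so \<open>x\<close> is known to
    minimise only once some minimiser exists.\<close>
  then have "is_arg_min (\<lambda>u. \<psi> u + ereal (1 / (2 * t) * (norm (p - u))\<^sup>2)) (\<lambda>_. True) x"
    unfolding x prox_def arg_min_def p_def by (rule someI_ex)
  then have min: "\<psi> x + ereal (c * (norm (x - p))\<^sup>2) \<le> \<psi> u + ereal (c * (norm (u - p))\<^sup>2)" for u
    by (simp add: is_arg_min_linorder c_def norm_minus_commute[of p])
  have "\<psi> x \<noteq> \<infinity>" using min[of w] \<open>\<psi> w \<noteq> \<infinity>\<close> by auto
  then obtain a where a: "\<psi> x = ereal a"
    using \<psi> by (cases "\<psi> x") (auto simp: closed_convex_fun_def)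
  have "\<psi> w \<le> ereal (b - \<phi> w)"
    using w by (cases "\<psi> w") auto
  then have "a + c * (norm (x - p))\<^sup>2 + c * (norm (w - x))\<^sup>2 \<le> b - \<phi> w + c * (norm (w - p))\<^sup>2"
    using \<psi> min a
    by (intro minimizer_plus_square_three_point[where h = \<psi>]) (auto simp: closed_convex_fun_def)
  \<comment> \<open>At \<open>u = x\<close> the finite value of \<open>\<psi>\<close> cancels, and
    the decrease condition becomes the quadratic upper bound on \<open>\<phi> x\<close>.\<close>
  moreover have "\<phi> x + d \<le> c * (norm (x - p))\<^sup>2"
    using model[of x] by (simp add: a)
  ultimately have "\<phi> x + a \<le> b + c * ((norm (w - y))\<^sup>2 - (norm (w - x))\<^sup>2)"
    using tangent[of w] unfolding square[of w] by (simp add: algebra_simps)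
  then show ?thesis by (simp add: a c_def)
qed

section \<open>Sums and multiples of closed convex functions\<close>

text \<open>The epigraph of the sum is the preimage of that of \<open>\<psi>\<close> under the
  continuous shear that lowers the height at \<open>u\<close> by \<open>\<phi> u\<close>.\<close>

lemma closed_convex_fun_add_convex:
  fixes \<phi> :: "'a::real_normed_vector \<Rightarrow> real"
  assumes \<phi>: "convex_on UNIV \<phi>" "continuous_on UNIV \<phi>" and \<psi>: "closed_convex_fun \<psi>"
  shows "closed_convex_fun (\<lambda>u. ereal (\<phi> u) + \<psi> u)"
proof -
  let ?E = "ereal_epigraph (\<lambda>u. ereal (\<phi> u) + \<psi> u)"
  have E: "(u, r) \<in> ?E \<longleftrightarrow> \<psi> u \<le> ereal (r - \<phi> u)" for u r
    by (cases "\<psi> u") (auto simp: ereal_epigraph_def)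
  have "?E = (\<lambda>q. (fst q, snd q - \<phi> (fst q))) -` ereal_epigraph \<psi>"
    by (auto simp: E) (auto simp: ereal_epigraph_def)
  moreover have "continuous_on UNIV (\<lambda>q::'a \<times> real. \<phi> (fst q))"
    by (rule continuous_on_compose2[OF \<phi>(2)]) (auto intro: continuous_intros)
  ultimately have "closed ?E"
    using \<psi> by (auto simp: closed_convex_fun_def intro!: closed_vimage continuous_intros)
  moreover have "convex ?E"
    unfolding convex_alt
  proof clarify
    fix u a v b and s :: real
    assume *: "(u, a) \<in> ?E" "(v, b) \<in> ?E" "0 \<le> s" "s \<le> 1"
    have "\<psi> ((1 - s) *\<^sub>R u + s *\<^sub>R v) \<le> ereal ((1 - s) * (a - \<phi> u) + s * (b - \<phi> v))"
      using * \<psi> by (intro convex_ereal_epigraphD) (auto simp: E closed_convex_fun_def)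
    also have "\<dots> \<le> ereal ((1 - s) * a + s * b - \<phi> ((1 - s) *\<^sub>R u + s *\<^sub>R v))"
      using convex_onD[OF \<phi>(1) \<open>0 \<le> s\<close> \<open>s \<le> 1\<close>, of u v] by (simp add: algebra_simps)
    finally show "(1 - s) *\<^sub>R (u, a) + s *\<^sub>R (v, b) \<in> ?E" by (simp add: E)
  qed
  ultimately show ?thesis
    using \<psi> by (auto simp: closed_convex_fun_def)
qed

text \<open>\<open>R\<close> may be infinite: the product is then \<open>0\<close> where
  \<open>f u = \<beta>\<close> and \<open>\<infinity>\<close> elsewhere, the indicator of a closed
  convex set.\<close>

lemma closed_convex_fun_scale:
  fixes f :: "'a::real_normed_vector \<Rightarrow> ereal"
  assumes f: "closed_convex_fun f" and lower: "\<And>u. ereal \<beta> \<le> f u" and "R > 0"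
  shows "closed_convex_fun (\<lambda>u. R * (f u - ereal \<beta>))"
proof -
  let ?E = "ereal_epigraph (\<lambda>u. R * (f u - ereal \<beta>))"
  have cvx: "convex (ereal_epigraph f)" and cl: "closed (ereal_epigraph f)"
    using f by (auto simp: closed_convex_fun_def)
  have nonneg: "0 \<le> R * (f u - ereal \<beta>)" for u
    using lower[of u] \<open>R > 0\<close> by (cases "f u") auto
  \<comment> \<open>\<open>\<rho>\<close> is the reciprocal of \<open>R\<close>, read as
    \<open>0\<close> for infinite \<open>R\<close>. One description of the epigraph then covers both
    cases.\<close>
  obtain \<rho> where \<rho>: "\<rho> \<ge> 0"
    and E: "\<And>u r. (u, r) \<in> ?E \<longleftrightarrow> 0 \<le> r \<and> f u \<le> ereal (\<beta> + \<rho> * r)"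
  proof (cases R)
    case (real r0)
    show thesis
    proof (rule that)
      show "(u, r) \<in> ?E \<longleftrightarrow> 0 \<le> r \<and> f u \<le> ereal (\<beta> + inverse r0 * r)" for u r
      proof (cases "f u")
        case (real a)
        then have "0 \<le> r0 * (a - \<beta>)"
          using nonneg[of u] \<open>R = ereal r0\<close> by simp
        moreover have "r0 * (a - \<beta>) \<le> r \<longleftrightarrow> a \<le> \<beta> + inverse r0 * r"
          using \<open>R = ereal r0\<close> \<open>R > 0\<close> by (simp add: field_simps)
        ultimately show ?thesis
          using real \<open>R = ereal r0\<close> by (auto simp: ereal_epigraph_def)
      qed (use \<open>R > 0\<close> real lower[of u] in \<open>auto simp: ereal_epigraph_def\<close>)
    qed (use \<open>R > 0\<close> real in auto)
  next
    case PInf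
    show thesis
    proof (rule that[of 0])
      show "(u, r) \<in> ?E \<longleftrightarrow> 0 \<le> r \<and> f u \<le> ereal (\<beta> + 0 * r)" for u r
        using PInf lower[of u]
        by (cases "f u") (auto simp: ereal_epigraph_def)
    qed simp
  qed (use \<open>R > 0\<close> in auto)
  have "?E = (\<lambda>q. (fst q, \<beta> + \<rho> * snd q)) -` ereal_epigraph f \<inter> {q. 0 \<le> snd q}"
    by (auto simp: E) (auto simp: ereal_epigraph_def)
  then have "closed ?E"
    using cl by (auto intro!: closed_Int closed_vimage closed_Collect_le continuous_intros)
  moreover have "convex ?E"
    unfolding convex_alt
  proof clarify
    fix u a v b and s :: real
    assume *: "(u, a) \<in> ?E" "(v, b) \<in> ?E" "0 \<le> s" "s \<le> 1"
    have "f ((1 - s) *\<^sub>R u + s *\<^sub>R v) \<le> ereal ((1 - s) * (\<beta> + \<rho> * a) + s * (\<beta> + \<rho> * b))"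
      using * by (intro convex_ereal_epigraphD[OF cvx]) (auto simp: E)
    also have "(1 - s) * (\<beta> + \<rho> * a) + s * (\<beta> + \<rho> * b) = \<beta> + \<rho> * ((1 - s) * a + s * b)"
      by (simp add: algebra_simps)
    finally show "(1 - s) *\<^sub>R (u, a) + s *\<^sub>R (v, b) \<in> ?E"
      using * by (simp add: E)
  qed
  moreover have "R * (f u - ereal \<beta>) \<noteq> -\<infinity>" for u
    using nonneg[of u] by (metis MInfty_neq_ereal(1) ereal_infty_less_eq(2) zero_ereal_def)
  ultimately show ?thesis
    by (simp add: closed_convex_fun_def)
qed

theorem theorem2:
  fixes \<phi> :: "'a::euclidean_space \<Rightarrow> real"
    and \<psi> f :: "'a \<Rightarrow> ereal"
    and fbar :: real
    and \<theta> t :: "nat \<Rightarrow> real"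
    and x0 :: 'a
    and x y g z :: "nat \<Rightarrow> 'a"
    and R :: "nat \<Rightarrow> ereal"
    and Xbar :: "'a set"
  assumes \<phi>_diff: "\<And>u. \<phi> differentiable (at u)"
    and \<phi>_convex: "convex_on UNIV \<phi>"
    and \<psi>: "closed_convex_fun \<psi>"
    and f: "\<And>u. f u = ereal (\<phi> u) + \<psi> u"
    and fbar: "ereal fbar = (INF u. f u)"
    and \<theta>_range: "\<And>k. 0 < \<theta> k \<and> \<theta> k \<le> 1"
    and \<theta>_0: "\<theta> 0 = 1"
    and \<theta>_Suc: "\<And>k. (\<theta> (k + 1))\<^sup>2 \<ge> (\<theta> k)\<^sup>2 * (1 - \<theta> (k + 1))"
    and t_pos: "\<And>k. t k > 0"
    and t_decseq: "decseq t"
    and x_0: "x 0 = x0"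
    and y_0: "y 0 = x0"
    and x_Suc: "\<And>k. x (k + 1) = prox \<psi> (t k) (y k - t k *\<^sub>R gradient \<phi> (y k))"
    and y_Suc: "\<And>k. y (k + 1) =
        x (k + 1) + (\<theta> (k + 1) * (1 - \<theta> k) / \<theta> k) *\<^sub>R (x (k + 1) - x k)"
    and g: "\<And>k. x (k + 1) = y k - t k *\<^sub>R g k"
    and decrease: "\<And>k. f (x (k + 1)) \<le>
        (INF u. ereal (\<phi> (y k) + gradient \<phi> (y k) \<bullet> (u - y k)
                  + 1 / (2 * t k) * (norm (u - y k))\<^sup>2) + \<psi> u)"
    and z: "\<And>k. k \<ge> 1 \<Longrightarrow>
        z k = ((\<theta> (k - 1))\<^sup>2 / t (k - 1)) *\<^sub>R (\<Sum>i<k. (t i / \<theta> i) *\<^sub>R g i)"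
    and R_1: "R 1 = 1"
    \<comment> \<open>the quotient is \<open>\<infinity>\<close> when \<open>\<theta> k = 1\<close>, and \<open>\<infinity> * 0 = 0\<close> below\<close>
    and R_Suc: "\<And>k. k \<ge> 1 \<Longrightarrow>
        R (k + 1) = ereal (t (k - 1) / t k)
          * (ereal ((\<theta> k)\<^sup>2) / ereal ((\<theta> (k - 1))\<^sup>2 * (1 - \<theta> k))) * R k"
    and Xbar: "Xbar = {u. f u = ereal fbar}"
  shows "(\<forall>k\<ge>1. R (k + 1) \<ge> 1) \<and>
    (\<forall>k\<ge>1. f (x k) - ereal fbar
        \<le> - convex_conjugate (\<lambda>u. R k * (f u - ereal fbar)) (z k)
           + ereal (z k \<bullet> x0)
           - ereal (t (k - 1) / (2 * (\<theta> (k - 1))\<^sup>2) * (norm (z k))\<^sup>2)) \<and>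
    (Xbar \<noteq> {} \<longrightarrow>
      (\<forall>k\<ge>1.
        let Q = (\<lambda>u. R k * (f u - ereal fbar)
                   + ereal ((\<theta> (k - 1))\<^sup>2 / (2 * t (k - 1)) * (norm (u - x0))\<^sup>2))
        in \<exists>u. is_arg_min Q (\<lambda>_. True) u
             \<and> f (x k) - ereal fbar \<le> Q u
             \<and> Q u \<le> ereal ((\<theta> (k - 1))\<^sup>2 * (infdist x0 Xbar)\<^sup>2 / (2 * t (k - 1)))))"
proof -

  \<comment> \<open>Weights and auxiliary points\<close>
  define v where "v = (\<lambda>k. x0 - (\<Sum>i<k. (t i / \<theta> i) *\<^sub>R g i))"
  define A where "A = (\<lambda>k. t k / (\<theta> k)\<^sup>2)"
  define B where "B = (\<lambda>k. \<Sum>i<k. t i / \<theta> i)"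
  have \<theta>: "0 < \<theta> k" "\<theta> k \<le> 1" for k using \<theta>_range by auto
  have A_pos: "A k > 0" for k using \<theta>(1)[of k] t_pos[of k] by (simp add: A_def)
  have A_\<theta>: "A k * \<theta> k = t k / \<theta> k" for k by (simp add: A_def power2_eq_square)
  \<comment> \<open>The recursion for \<open>\<theta>\<close> and the monotonicity of
    \<open>t\<close> enter through this single inequality.\<close>
  have A_Suc: "A (Suc k) * (1 - \<theta> (Suc k)) \<le> A k" for k
  proof -
    have "(1 - \<theta> (Suc k)) / (\<theta> (Suc k))\<^sup>2 \<le> 1 / (\<theta> k)\<^sup>2"
      using \<theta>_Suc[of k] \<theta>(1)[of k] \<theta>(1)[of "Suc k"] by (simp add: field_simps)
    moreover have "t (Suc k) \<le> t k" using t_decseq by (simp add: decseq_Suc_iff)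
    ultimately have "t (Suc k) * ((1 - \<theta> (Suc k)) / (\<theta> (Suc k))\<^sup>2) \<le> t k * (1 / (\<theta> k)\<^sup>2)"
      using t_pos[of k] \<theta>(2)[of "Suc k"] by (intro mult_mono) auto
    then show ?thesis by (simp add: A_def)
  qed

  \<comment> \<open>The extrapolation identity\<close>
  have v_Suc: "v (Suc k) = v k - (t k / \<theta> k) *\<^sub>R g k" for k
    by (simp add: v_def)
  \<comment> \<open>Stated conditionally, because the induction that proves its premise uses
    it.\<close>
  have xv_of_yv: "x (Suc k) = (1 - \<theta> k) *\<^sub>R x k + \<theta> k *\<^sub>R v (Suc k)"
    if "y k = (1 - \<theta> k) *\<^sub>R x k + \<theta> k *\<^sub>R v k" for k
    using g[of k] \<theta>(1)[of k] by (simp add: that v_Suc scaleR_diff_right)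
  have yv: "y k = (1 - \<theta> k) *\<^sub>R x k + \<theta> k *\<^sub>R v k" for k
  proof (induction k)
    case 0
    show ?case by (simp add: y_0 \<theta>_0 v_def)
  next
    case (Suc k)
    define q where "q = \<theta> (Suc k) / \<theta> k"
    have q: "q * \<theta> k = \<theta> (Suc k)" using \<theta>(1)[of k] by (simp add: q_def)
    have "\<theta> (Suc k) *\<^sub>R v (Suc k) = q *\<^sub>R (\<theta> k *\<^sub>R v (Suc k))"
      by (simp add: q)
    also have "\<theta> k *\<^sub>R v (Suc k) = x (Suc k) - (1 - \<theta> k) *\<^sub>R x k"
      using xv_of_yv[OF Suc.IH] by simp
    finally have "(1 - \<theta> (Suc k)) *\<^sub>R x (Suc k) + \<theta> (Suc k) *\<^sub>R v (Suc k) =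
        x (Suc k) + (q * (1 - \<theta> k)) *\<^sub>R (x (Suc k) - x k)"
      unfolding q[symmetric] by (simp add: algebra_simps)
    moreover have "y (Suc k) = x (Suc k) + (q * (1 - \<theta> k)) *\<^sub>R (x (Suc k) - x k)"
      using y_Suc[of k] by (simp add: q_def)
    ultimately show ?case by simp
  qed
  note xv = xv_of_yv[OF yv]

  \<comment> \<open>Properties of \<open>f\<close> and the one-step inequality\<close>
  have f_closed: "closed_convex_fun f"
  proof -
    have "continuous_on UNIV \<phi>"
      using \<phi>_diff by (simp add: differentiable_imp_continuous_on differentiable_on_def)
    moreover have "f = (\<lambda>u. ereal (\<phi> u) + \<psi> u)" by (rule ext) (rule f)
    ultimately show ?thesis
      using closed_convex_fun_add_convex \<phi>_convex \<psi> by metis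
  qed
  have f_lower: "ereal fbar \<le> f u" for u
    unfolding fbar by (rule INF_lower) simp
  have gap_nonneg: "0 \<le> f u - ereal fbar" for u
    using f_lower[of u] by (cases "f u") auto

  have step: "f (x (Suc k)) \<le> ereal (b + 1 / (2 * t k) * ((norm (w - y k))\<^sup>2 - (norm (w - x (Suc k)))\<^sup>2))"
    if "f w \<le> ereal b" for k w b
    unfolding f
  proof (rule prox_step_bound)
    show "\<phi> (y k) + gradient \<phi> (y k) \<bullet> (u - y k) \<le> \<phi> u" for u
      using gradient_tangent_below \<phi>_diff \<phi>_convex by blast
  qed (use that \<psi> t_pos x_Suc[of k] decrease[of k] f_lower[of "x (Suc k)"] in \<open>simp_all add: f\<close>)

  \<comment> \<open>Finiteness is claimed from index 1 on only; \<open>f x0\<close> may be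
    infinite.\<close>
  have "\<exists>F. f (x (Suc k)) = ereal (fbar + F) \<and> 0 \<le> F" for k
  proof -
    have "(INF u. f u) < \<infinity>" by (simp flip: fbar)
    then obtain u where "f u < \<infinity>" unfolding INF_less_iff by blast
    then obtain b where "f u \<le> ereal b" by (cases "f u") auto
    from step[OF this, of k] f_lower[of "x (Suc k)"] obtain r where "f (x (Suc k)) = ereal r" "fbar \<le> r"
      by (cases "f (x (Suc k))") auto
    then show ?thesis by (intro exI[of _ "r - fbar"]) simp
  qed
  then obtain F where F: "\<And>k. f (x (Suc k)) = ereal (fbar + F k)" and F_nonneg: "\<And>k. 0 \<le> F k"
    by metis

  \<comment> \<open>The energy estimate\<close>
  have energy: "A k * F k + (norm (u - v (Suc k)))\<^sup>2 / 2 \<le> B (Suc k) * e + (norm (u - x0))\<^sup>2 / 2"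
    if u: "f u = ereal (fbar + e)" for k u e
  proof (induction k)
    case 0
    \<comment> \<open>As \<open>\<theta> 0 = 1\<close>, the test point is \<open>u\<close> itself
      and the value at \<open>x 0\<close> does not enter.\<close>
    have "f (x 1) \<le> ereal (fbar + e + 1 / (2 * t 0) * ((norm (u - y 0))\<^sup>2 - (norm (u - x 1))\<^sup>2))"
      using step[of u "fbar + e" 0] u by simp
    moreover have "x 1 = v 1" using xv[of 0] by (simp add: \<theta>_0)
    ultimately have "F 0 \<le> e + 1 / (2 * t 0) * ((norm (u - x0))\<^sup>2 - (norm (u - v 1))\<^sup>2)"
      using F[of 0] by (simp add: y_0)
    then have "t 0 * F 0 \<le> t 0 * (e + 1 / (2 * t 0) * ((norm (u - x0))\<^sup>2 - (norm (u - v 1))\<^sup>2))"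
      using t_pos[of 0] by simp
    also have "\<dots> = t 0 * e + ((norm (u - x0))\<^sup>2 - (norm (u - v 1))\<^sup>2) / 2"
      using t_pos[of 0] by (simp add: distrib_left)
    finally show ?case
      by (simp add: A_def B_def \<theta>_0 diff_divide_distrib)
  next
    case (Suc k)
    let ?\<theta> = "\<theta> (Suc k)" and ?A = "A (Suc k)"
    \<comment> \<open>With this test point both differences in the one-step inequality are
      \<open>?\<theta>\<close> times differences from \<open>u\<close> to consecutive
      \<open>v\<close>, so the squares telescope.\<close>
    let ?w = "(1 - ?\<theta>) *\<^sub>R x (Suc k) + ?\<theta> *\<^sub>R u"
    let ?d = "(norm (u - v (Suc k)))\<^sup>2 - (norm (u - v (Suc (Suc k))))\<^sup>2"
    have "f ?w \<le> ereal ((1 - ?\<theta>) * (fbar + F k) + ?\<theta> * (fbar + e))"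
      using f_closed F u \<theta>[of "Suc k"]
      by (intro convex_ereal_epigraphD) (auto simp: closed_convex_fun_def)
    from step[OF this, of "Suc k"]
    have "fbar + F (Suc k) \<le> (1 - ?\<theta>) * (fbar + F k) + ?\<theta> * (fbar + e) +
        1 / (2 * t (Suc k)) * ((norm (?w - y (Suc k)))\<^sup>2 - (norm (?w - x (Suc (Suc k))))\<^sup>2)"
      by (simp only: F ereal_less_eq)
    moreover have "?w - y (Suc k) = ?\<theta> *\<^sub>R (u - v (Suc k))"
      unfolding yv[of "Suc k"] by (simp add: algebra_simps)
    then have "(norm (?w - y (Suc k)))\<^sup>2 = ?\<theta>\<^sup>2 * (norm (u - v (Suc k)))\<^sup>2"
      by (simp only: norm_scaleR power_mult_distrib power2_abs)
    moreover have "?w - x (Suc (Suc k)) = ?\<theta> *\<^sub>R (u - v (Suc (Suc k)))"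
      unfolding xv[of "Suc k"] by (simp add: algebra_simps)
    then have "(norm (?w - x (Suc (Suc k))))\<^sup>2 = ?\<theta>\<^sup>2 * (norm (u - v (Suc (Suc k))))\<^sup>2"
      by (simp only: norm_scaleR power_mult_distrib power2_abs)
    ultimately have "fbar + F (Suc k) \<le> (1 - ?\<theta>) * (fbar + F k) + ?\<theta> * (fbar + e)
        + 1 / (2 * t (Suc k)) * (?\<theta>\<^sup>2 * ?d)"
      by (simp only: right_diff_distrib)
    then have "F (Suc k) \<le> (1 - ?\<theta>) * F k + ?\<theta> * e + 1 / (2 * t (Suc k)) * (?\<theta>\<^sup>2 * ?d)"
      by (simp add: algebra_simps)
    also have "1 / (2 * t (Suc k)) * (?\<theta>\<^sup>2 * ?d) = ?d / (2 * ?A)"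
      using \<theta>(1)[of "Suc k"] t_pos[of "Suc k"] by (simp add: A_def field_simps)
    finally have "?A * F (Suc k) \<le> ?A * ((1 - ?\<theta>) * F k + ?\<theta> * e + ?d / (2 * ?A))"
      using A_pos[of "Suc k"] by simp
    also have "\<dots> = ?A * (1 - ?\<theta>) * F k + t (Suc k) / ?\<theta> * e + ?d / 2"
      using A_pos[of "Suc k"] by (simp add: distrib_left flip: A_\<theta>)
    also have "\<dots> \<le> A k * F k + t (Suc k) / ?\<theta> * e + ?d / 2"
      using mult_right_mono[OF A_Suc F_nonneg] by simp
    finally have "?A * F (Suc k) \<le> A k * F k + t (Suc k) / ?\<theta> * e + ?d / 2" .
    moreover have "B (Suc (Suc k)) * e = B (Suc k) * e + t (Suc k) / ?\<theta> * e"
      by (simp add: B_def distrib_right)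
    ultimately show ?case
      using Suc.IH by (simp add: diff_divide_distrib)
  qed

  \<comment> \<open>Lower bounds for the multipliers\<close>
  \<comment> \<open>The induction for the second bound also needs the first: both are multiplied by
    the growth factor \<open>c\<close>.\<close>
  have R: "1 \<le> R (Suc k) \<and> ereal (B (Suc k) / A k) \<le> R (Suc k)" for k
  proof (induction k)
    case 0
    show ?case using R_1 t_pos[of 0] by (simp add: A_def B_def \<theta>_0)
  next
    case (Suc k)
    let ?\<theta> = "\<theta> (Suc k)"
    have RSS: "R (Suc (Suc k)) = ereal (t k / t (Suc k))
          * (ereal (?\<theta>\<^sup>2) / ereal ((\<theta> k)\<^sup>2 * (1 - ?\<theta>))) * R (Suc k)"
      using R_Suc[of "Suc k"] by simp
    show ?case
    proof (cases "?\<theta> = 1")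
      case True
      have "0 < R (Suc k)" using Suc.IH by (auto intro: less_le_trans[of 0 1])
      \<comment> \<open>A positive number divided by the extended real \<open>0\<close> is
        \<open>\<infinity>\<close>, and positivity of \<open>R (Suc k)\<close> keeps the product
        infinite.\<close>
      then have "R (Suc (Suc k)) = \<infinity>"
        using t_pos[of k] t_pos[of "Suc k"] unfolding RSS True by (simp add: divide_ereal_def)
      then show ?thesis by simp
    next
      case False
      then have \<theta>1: "?\<theta> < 1" using \<theta>(2)[of "Suc k"] by simp
      \<comment> \<open>This is the finite factor in the recursion for \<open>R\<close>;
        \<open>A_Suc\<close> says that it is at least 1.\<close>
      define c where "c = A k / (A (Suc k) * (1 - ?\<theta>))"
      have "0 < A (Suc k) * (1 - ?\<theta>)" using A_pos[of "Suc k"] \<theta>1 by simp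
      then have c: "1 \<le> c" using A_Suc[of k] by (simp add: c_def)
      have "R (Suc (Suc k)) = ereal c * R (Suc k)"
        using \<theta>1 \<theta>(1)[of k] \<theta>(1)[of "Suc k"] t_pos[of k] t_pos[of "Suc k"]
        unfolding RSS by (simp add: c_def A_def mult.left_commute)
      then have mono: "ereal (c * r) \<le> R (Suc (Suc k))" if "ereal r \<le> R (Suc k)" for r
        using ereal_mult_left_mono[OF that, of "ereal c"] c by simp
      have one: "ereal c \<le> R (Suc (Suc k))"
        using mono[of 1] Suc.IH by (simp add: one_ereal_def)
      have quot: "ereal (c * (B (Suc k) / A k)) \<le> R (Suc (Suc k))"
        using mono Suc.IH by blast
      \<comment> \<open>With \<open>c \<ge> 1\<close> the right side is at most a convex combination
        of \<open>c * (B (Suc k) / A k)\<close> and \<open>c\<close>, two lower bounds for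
        \<open>R (Suc (Suc k))\<close>.\<close>
      have "B (Suc (Suc k)) / A (Suc k) = (1 - ?\<theta>) * (c * (B (Suc k) / A k)) + ?\<theta>"
      proof -
        have "t (Suc k) / ?\<theta> / A (Suc k) = ?\<theta>"
          using A_pos[of "Suc k"] by (simp flip: A_\<theta>)
        moreover have "(1 - ?\<theta>) * (c * (B (Suc k) / A k)) = B (Suc k) / A (Suc k)"
          using A_pos[of k] A_pos[of "Suc k"] \<theta>1 by (simp add: c_def)
        ultimately show ?thesis by (simp add: B_def add_divide_distrib)
      qed
      also have "\<dots> \<le> (1 - ?\<theta>) * (c * (B (Suc k) / A k)) + ?\<theta> * c"
        using c \<theta>(1)[of "Suc k"] by simp
      also have "\<dots> \<le> max (c * (B (Suc k) / A k)) c"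
        using \<theta>1 \<theta>(1)[of "Suc k"] by (intro convex_bound_le) auto
      finally have "ereal (B (Suc (Suc k)) / A (Suc k)) \<le> R (Suc (Suc k))"
        using one quot ereal_less_eq(3) order_trans unfolding max_def by (smt (verit))
      moreover have "1 \<le> R (Suc (Suc k))"
        using c one order_trans[of 1 "ereal c"] by (simp add: one_ereal_def)
      ultimately show ?thesis by simp
    qed
  qed

  \<comment> \<open>The conjugate bound\<close>
  have gap_le: "ereal (F k) \<le> R (Suc k) * (f u - ereal fbar)
      + ereal (1 / (2 * A k) * ((norm (u - x0))\<^sup>2 - (norm (u - v (Suc k)))\<^sup>2))" for k u
  proof (cases "f u")
    case (real r)
    define e where "e = r - fbar"
    have e: "f u = ereal (fbar + e)" "f u - ereal fbar = ereal e" "0 \<le> e"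
      using real f_lower[of u] by (auto simp: e_def)
    have "A k * F k \<le> B (Suc k) * e + ((norm (u - x0))\<^sup>2 - (norm (u - v (Suc k)))\<^sup>2) / 2"
      using energy[OF e(1), of k] by (simp add: diff_divide_distrib)
    then have "F k \<le> B (Suc k) / A k * e + 1 / (2 * A k) * ((norm (u - x0))\<^sup>2 - (norm (u - v (Suc k)))\<^sup>2)"
      using A_pos[of k] by (simp add: field_simps)
    then have "ereal (F k) \<le> ereal (B (Suc k) / A k * e)
        + ereal (1 / (2 * A k) * ((norm (u - x0))\<^sup>2 - (norm (u - v (Suc k)))\<^sup>2))"
      by simp
    moreover have "ereal (B (Suc k) / A k * e) \<le> R (Suc k) * ereal e"
      using ereal_mult_right_mono[of "ereal (B (Suc k) / A k)" "R (Suc k)" "ereal e"] R e(3) by simp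
    ultimately show ?thesis
      unfolding e(2) by (meson add_right_mono order_trans)
  next
    case PInf
    then have "R (Suc k) * (f u - ereal fbar) = \<infinity>"
      using R[of k] by (cases "R (Suc k)") (auto simp: one_ereal_def)
    then show ?thesis by (simp only: plus_ereal.simps ereal_less_eq)
  qed (use f_lower[of u] in simp)

  have conj_bound: "ereal (F k) \<le> - convex_conjugate (\<lambda>u. R (Suc k) * (f u - ereal fbar)) (z (Suc k))
           + ereal (z (Suc k) \<bullet> x0) - ereal (A k / 2 * (norm (z (Suc k)))\<^sup>2)" for k
  proof -
    let ?z = "z (Suc k)"
    let ?C = "convex_conjugate (\<lambda>u. R (Suc k) * (f u - ereal fbar)) ?z"
    \<comment> \<open>This makes the difference of squares in \<open>gap_le\<close> affine in
      \<open>u\<close>, so the supremum over \<open>u\<close> is a conjugate at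
      \<open>?z\<close>.\<close>
    have Az: "A k *\<^sub>R ?z = x0 - v (Suc k)"
      using z[of "Suc k"] \<theta>(1)[of k] t_pos[of k] by (simp add: v_def A_def)
    have "ereal (?z \<bullet> u) - R (Suc k) * (f u - ereal fbar)
        \<le> ereal (?z \<bullet> x0 - A k / 2 * (norm ?z)\<^sup>2 - F k)" for u
    proof -
      have "u - v (Suc k) = (u - x0) + A k *\<^sub>R ?z" by (simp add: Az)
      then have "(norm (u - v (Suc k)))\<^sup>2 = (norm (u - x0))\<^sup>2 + 2 * A k * (?z \<bullet> (u - x0)) + (A k)\<^sup>2 * (norm ?z)\<^sup>2"
        by (simp only: power2_norm_eq_inner inner_add_left inner_add_right inner_scaleR_left
            inner_scaleR_right inner_commute[of "u - x0" ?z]) (simp add: power2_eq_square algebra_simps)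
      then have "1 / (2 * A k) * ((norm (u - x0))\<^sup>2 - (norm (u - v (Suc k)))\<^sup>2)
          = ?z \<bullet> x0 - ?z \<bullet> u - A k / 2 * (norm ?z)\<^sup>2"
        using A_pos[of k] by (simp add: inner_diff_right field_simps power2_eq_square)
      with gap_le[of k u] show ?thesis
        by (cases "R (Suc k) * (f u - ereal fbar)") auto
    qed
    then have "?C \<le> ereal (?z \<bullet> x0 - A k / 2 * (norm ?z)\<^sup>2 - F k)"
      unfolding convex_conjugate_def by (rule SUP_least)
    then show ?thesis by (cases ?C) auto
  qed

  \<comment> \<open>The distance bound\<close>
  have argmin: "let Q = (\<lambda>u. R (Suc k) * (f u - ereal fbar) + ereal (1 / (2 * A k) * (norm (u - x0))\<^sup>2))
      in \<exists>u. is_arg_min Q (\<lambda>_. True) u \<and> ereal (F k) \<le> Q u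
           \<and> Q u \<le> ereal (1 / (2 * A k) * (infdist x0 Xbar)\<^sup>2)" if "Xbar \<noteq> {}" for k
  proof -
    define h where "h = (\<lambda>u. R (Suc k) * (f u - ereal fbar))"
    define Q where "Q = (\<lambda>u. h u + ereal (1 / (2 * A k) * (norm (u - x0))\<^sup>2))"
    have "0 < R (Suc k)" using R[of k] by (auto intro: less_le_trans[of 0 1])
    then have h: "closed_convex_fun h"
      unfolding h_def using closed_convex_fun_scale f_closed f_lower by blast
    have h_nonneg: "0 \<le> h u" for u
      using gap_nonneg[of u] \<open>0 < R (Suc k)\<close> by (simp add: h_def)
    have "closed Xbar"
    proof -
      have "Xbar = (\<lambda>u. (u, fbar)) -` ereal_epigraph f"
        using f_lower by (auto simp: Xbar ereal_epigraph_def intro: antisym)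
      then show ?thesis
        using f_closed by (auto simp: closed_convex_fun_def intro!: closed_vimage continuous_intros)
    qed
    then obtain u0 where u0: "u0 \<in> Xbar" "infdist x0 Xbar = dist x0 u0"
      using infdist_attains_inf \<open>Xbar \<noteq> {}\<close> by metis
    \<comment> \<open>Also for infinite \<open>R (Suc k)\<close>, since
      \<open>\<infinity> * 0 = 0\<close>. The nearest minimiser \<open>u0\<close> therefore costs
      only the square.\<close>
    then have "h u0 = 0" by (simp add: h_def Xbar)
    have "ereal 0 \<le> Q u" for u
      using h_nonneg[of u] A_pos[of k] by (cases "h u") (auto simp: Q_def)
    then obtain u where u: "\<And>w. Q u \<le> Q w"
      using closed_convex_fun_plus_square_attains_min[OF h, of "1 / (2 * A k)" 0 x0 u0] A_pos[of k] \<open>h u0 = 0\<close>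
      by (auto simp: Q_def)
    have "ereal (F k) \<le> Q u"
    proof -
      have "1 / (2 * A k) * ((norm (u - x0))\<^sup>2 - (norm (u - v (Suc k)))\<^sup>2) \<le> 1 / (2 * A k) * (norm (u - x0))\<^sup>2"
        using A_pos[of k] by (intro mult_left_mono) auto
      then show ?thesis
        unfolding Q_def h_def by (intro order_trans[OF gap_le[of k u]] add_left_mono) simp
    qed
    moreover have "Q u \<le> ereal (1 / (2 * A k) * (infdist x0 Xbar)\<^sup>2)"
      using u[of u0] \<open>h u0 = 0\<close> u0(2) by (simp add: Q_def dist_norm norm_minus_commute)
    ultimately show ?thesis
      using u unfolding Let_def is_arg_min_linorder Q_def h_def by blast
  qed

  \<comment> \<open>Translation to the coefficients of the statement, whose index \<open>k\<close>
    is one above that of \<open>A\<close> and \<open>F\<close>.\<close>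
  have coeffs: "(\<theta> k)\<^sup>2 / (2 * t k) = 1 / (2 * A k)" "t k / (2 * (\<theta> k)\<^sup>2) = A k / 2"
    "(\<theta> k)\<^sup>2 * d / (2 * t k) = 1 / (2 * A k) * d" for k d
    by (simp_all add: A_def)
  have gap: "f (x (Suc k)) - ereal fbar = ereal (F k)" for k
    by (simp add: F)
  show ?thesis
  proof (intro conjI allI impI)
    fix k :: nat assume "1 \<le> k"
    then obtain j where k: "k = Suc j" by (cases k) auto
    show "1 \<le> R (k + 1)" using R[of k] by simp
    show "f (x k) - ereal fbar \<le> - convex_conjugate (\<lambda>u. R k * (f u - ereal fbar)) (z k)
           + ereal (z k \<bullet> x0) - ereal (t (k - 1) / (2 * (\<theta> (k - 1))\<^sup>2) * (norm (z k))\<^sup>2)"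
      using conj_bound[of j] by (simp only: k gap coeffs diff_Suc_1)
    assume "Xbar \<noteq> {}"
    from argmin[OF this, of j]
    show "let Q = (\<lambda>u. R k * (f u - ereal fbar)
                   + ereal ((\<theta> (k - 1))\<^sup>2 / (2 * t (k - 1)) * (norm (u - x0))\<^sup>2))
        in \<exists>u. is_arg_min Q (\<lambda>_. True) u
             \<and> f (x k) - ereal fbar \<le> Q u
             \<and> Q u \<le> ereal ((\<theta> (k - 1))\<^sup>2 * (infdist x0 Xbar)\<^sup>2 / (2 * t (k - 1)))"
      by (simp only: k gap coeffs diff_Suc_1)
  qed
qed

end
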